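(* Let $X$ be a topological space and let $\mathfrak{B}$ be a collection of open subsets of $X$ satisfying the properties $(B_I)$ and $(B_{II})$; endow $X$ with the uniform structure $\mathfrak{U}$ determined by $\mathfrak{B}$. Then the Hausdorff completion $\widehat{X}$ of $X$ is a compact uniform space.
   Context: $\mathfrak{C}$ denotes the collection of all finite covers of $X$ by elements of $\mathfrak{B}$. The properties are: $(B_I)$ Every non-empty finite intersection of elements of $\mathfrak{B}$ belongs to $\mathfrak{B}$ (here "finite intersection" includes the intersection of the empty family, which is $X$). $(B_{II})$ For every cover $C\in\mathfrak{C}$ there is a cover $C'\in\mathfrak{C}$ such that for every point $x\in X$ the union of all the elements of $C'$ containing $x$ is contained in one of the elements of $C$. For $C\in\mathfrak{C}$, $V(C)=\bigcup_{Y\in C}Y\times Y$, and $\mathfrak{U}$ is the uniform structure on $X$ consisting of all $V\subset X\times X$ containing $V(C)$ for some $C\in\mathfrak{C}$; its elements are called entourages. A subset $Y\subset X$ is $V$-small if $Y\times Y\subset V$; a filter on $X$ is Cauchy if for every entourage $V$ it contains a $V$-small set. The Hausdorff completion $\widehat{X}$ is the set of all Cauchy filters on $X$ that are minimal (for inclusion) among Cauchy filters, with the uniform structure consisting of all subsets of $\widehat{X}\times\widehat{X}$ containing a set of the form $\{(\mathfrak{F},\mathfrak{F}')\in\widehat{X}\times\widehat{X}: \mathfrak{F}\text{ and }\mathfrak{F}'\text{ contain a common } V\text{-small set}\}$, with $V$ an entourage of $X$. Compact means Hausdorff and every open cover has a finite subcover. *)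

theory Defs
  imports "HOL-Analysis.T1_Spaces"
begin

section \<open>Uniform structures on a carrier set\<close>

definition uniform_structure_on :: "'a set \<Rightarrow> ('a \<times> 'a) set set \<Rightarrow> bool" where
  "uniform_structure_on S \<U> \<longleftrightarrow>
     S \<times> S \<in> \<U> \<and>
     (\<forall>V\<in>\<U>. V \<subseteq> S \<times> S \<and> Id_on S \<subseteq> V) \<and>
     (\<forall>V\<in>\<U>. \<forall>W. V \<subseteq> W \<and> W \<subseteq> S \<times> S \<longrightarrow> W \<in> \<U>) \<and>
     (\<forall>V\<in>\<U>. \<forall>W\<in>\<U>. V \<inter> W \<in> \<U>) \<and>
     (\<forall>V\<in>\<U>. converse V \<in> \<U>) \<and>
     (\<forall>V\<in>\<U>. \<exists>W\<in>\<U>. W O W \<subseteq> V)"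

definition uniform_topology :: "'a set \<Rightarrow> ('a \<times> 'a) set set \<Rightarrow> 'a topology" where
  "uniform_topology S \<U> =
     topology (\<lambda>T. T \<subseteq> S \<and> (\<forall>x\<in>T. \<exists>V\<in>\<U>. V `` {x} \<subseteq> T))"

lemma openin_uniform_topology:
  assumes "uniform_structure_on S \<U>"
  shows "openin (uniform_topology S \<U>) T \<longleftrightarrow>
           T \<subseteq> S \<and> (\<forall>x\<in>T. \<exists>V\<in>\<U>. V `` {x} \<subseteq> T)"
proof -
  have "istopology (\<lambda>T. T \<subseteq> S \<and> (\<forall>x\<in>T. \<exists>V\<in>\<U>. V `` {x} \<subseteq> T))"
    unfolding istopology_def
  proof (intro conjI allI impI)
    fix A B
    assume A: "A \<subseteq> S \<and> (\<forall>x\<in>A. \<exists>V\<in>\<U>. V `` {x} \<subseteq> A)"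
      and B: "B \<subseteq> S \<and> (\<forall>x\<in>B. \<exists>V\<in>\<U>. V `` {x} \<subseteq> B)"
    show "A \<inter> B \<subseteq> S" using A by blast
    show "\<forall>x\<in>A \<inter> B. \<exists>V\<in>\<U>. V `` {x} \<subseteq> A \<inter> B"
    proof
      fix x assume "x \<in> A \<inter> B"
      then obtain V W where "V \<in> \<U>" "V `` {x} \<subseteq> A" "W \<in> \<U>" "W `` {x} \<subseteq> B"
        using A B by blast
      moreover from this have "V \<inter> W \<in> \<U>"
        using assms unfolding uniform_structure_on_def by blast
      ultimately show "\<exists>V\<in>\<U>. V `` {x} \<subseteq> A \<inter> B" by blast
    qed
  next
    fix \<K>
    assume K: "\<forall>K\<in>\<K>. K \<subseteq> S \<and> (\<forall>x\<in>K. \<exists>V\<in>\<U>. V `` {x} \<subseteq> K)"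
    show "\<Union>\<K> \<subseteq> S" using K by blast
    show "\<forall>x\<in>\<Union>\<K>. \<exists>V\<in>\<U>. V `` {x} \<subseteq> \<Union>\<K>"
    proof
      fix x assume "x \<in> \<Union>\<K>"
      then obtain K where "K \<in> \<K>" "x \<in> K" by blast
      moreover from this obtain V where "V \<in> \<U>" "V `` {x} \<subseteq> K" using K by blast
      ultimately show "\<exists>V\<in>\<U>. V `` {x} \<subseteq> \<Union>\<K>" by blast
    qed
  qed
  then show ?thesis
    unfolding uniform_topology_def by (simp add: topology_inverse')
qed

lemma topspace_uniform_topology:
  assumes "uniform_structure_on S \<U>"
  shows "topspace (uniform_topology S \<U>) = S"
proof -
  have "S \<times> S \<in> \<U>" using assms by (simp add: uniform_structure_on_def)
  moreover have "(S \<times> S) `` {x} \<subseteq> S" for x by auto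
  ultimately have "openin (uniform_topology S \<U>) S"
    unfolding openin_uniform_topology[OF assms] by (intro conjI ballI order_refl bexI)
  moreover have "topspace (uniform_topology S \<U>) \<subseteq> S"
    using openin_uniform_topology[OF assms, of "topspace (uniform_topology S \<U>)"] by simp
  ultimately show ?thesis by (metis openin_subset subset_antisym)
qed

definition compact_uniform_space_on :: "'a set \<Rightarrow> ('a \<times> 'a) set set \<Rightarrow> bool" where
  "compact_uniform_space_on S \<U> \<longleftrightarrow>
     uniform_structure_on S \<U> \<and>
     Hausdorff_space (uniform_topology S \<U>) \<and>
     compact_space (uniform_topology S \<U>)"


section \<open>The Hausdorff completion\<close>

definition small_set :: "('a \<times> 'a) set \<Rightarrow> 'a set \<Rightarrow> bool" where
  "small_set V Y \<longleftrightarrow> Y \<times> Y \<subseteq> V"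

text \<open>
  A filter on the set \<open>S\<close> is represented by the filter on the ambient type that it generates,
  that is, by a filter below \<open>principal S\<close>; a set \<open>Y\<close> belongs to the filter \<open>F\<close> if
  \<open>\<forall>\<^sub>F x in F. x \<in> Y\<close>. As filters in the usual sense do not contain the empty set, \<open>bot\<close> is
  excluded.
\<close>

definition cauchy_filter_on :: "'a set \<Rightarrow> ('a \<times> 'a) set set \<Rightarrow> 'a filter \<Rightarrow> bool" where
  "cauchy_filter_on S \<U> F \<longleftrightarrow>
     F \<noteq> bot \<and> F \<le> principal S \<and>
     (\<forall>V\<in>\<U>. \<exists>Y. small_set V Y \<and> (\<forall>\<^sub>F x in F. x \<in> Y))"

text \<open>
  The order on the type of filters is opposite to inclusion: \<open>F \<le> G\<close> means that every set
  belonging to \<open>G\<close> belongs to \<open>F\<close>. Filters minimal for inclusion are therefore the maximal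
  elements with respect to \<open>\<le>\<close>.
\<close>

definition hausdorff_completion :: "'a set \<Rightarrow> ('a \<times> 'a) set set \<Rightarrow> 'a filter set" where
  "hausdorff_completion S \<U> =
     {F. cauchy_filter_on S \<U> F \<and> (\<forall>G. cauchy_filter_on S \<U> G \<and> F \<le> G \<longrightarrow> G = F)}"

definition completion_entourage ::
    "'a set \<Rightarrow> ('a \<times> 'a) set set \<Rightarrow> ('a \<times> 'a) set \<Rightarrow> ('a filter \<times> 'a filter) set" where
  "completion_entourage S \<U> V =
     {(F, F') \<in> hausdorff_completion S \<U> \<times> hausdorff_completion S \<U>.
        \<exists>Y. small_set V Y \<and> (\<forall>\<^sub>F x in F. x \<in> Y) \<and> (\<forall>\<^sub>F x in F'. x \<in> Y)}"

definition completion_uniformity ::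
    "'a set \<Rightarrow> ('a \<times> 'a) set set \<Rightarrow> ('a filter \<times> 'a filter) set set" where
  "completion_uniformity S \<U> =
     {W. W \<subseteq> hausdorff_completion S \<U> \<times> hausdorff_completion S \<U> \<and>
         (\<exists>V\<in>\<U>. completion_entourage S \<U> V \<subseteq> W)}"


section \<open>The uniform structure determined by a collection of open sets\<close>

definition finite_covers :: "'a topology \<Rightarrow> 'a set set \<Rightarrow> 'a set set set" where
  "finite_covers X \<B> = {C. finite C \<and> C \<subseteq> \<B> \<and> \<Union>C = topspace X}"

text \<open>
  Intersecting with \<open>topspace X\<close> matters only for the empty family, whose intersection is the
  whole space.
\<close>

definition property_BI :: "'a topology \<Rightarrow> 'a set set \<Rightarrow> bool" where
  "property_BI X \<B> \<longleftrightarrow>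
     (\<forall>\<F>. finite \<F> \<and> \<F> \<subseteq> \<B> \<and> topspace X \<inter> \<Inter>\<F> \<noteq> {} \<longrightarrow> topspace X \<inter> \<Inter>\<F> \<in> \<B>)"

definition property_BII :: "'a topology \<Rightarrow> 'a set set \<Rightarrow> bool" where
  "property_BII X \<B> \<longleftrightarrow>
     (\<forall>C\<in>finite_covers X \<B>. \<exists>C'\<in>finite_covers X \<B>.
        \<forall>x\<in>topspace X. \<exists>Y\<in>C. \<Union>{Z\<in>C'. x \<in> Z} \<subseteq> Y)"

definition cover_entourage :: "'a set set \<Rightarrow> ('a \<times> 'a) set" where
  "cover_entourage C = (\<Union>Y\<in>C. Y \<times> Y)"

definition uniformity_from :: "'a topology \<Rightarrow> 'a set set \<Rightarrow> ('a \<times> 'a) set set" where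
  "uniformity_from X \<B> =
     {V. V \<subseteq> topspace X \<times> topspace X \<and> (\<exists>C\<in>finite_covers X \<B>. cover_entourage C \<subseteq> V)}"

lemma uniform_structure_on_uniformity_from:
  assumes sub: "\<And>U. U \<in> \<B> \<Longrightarrow> openin X U"
    and BI: "property_BI X \<B>" and BII: "property_BII X \<B>"
  shows "uniform_structure_on (topspace X) (uniformity_from X \<B>)"
  unfolding uniform_structure_on_def
proof (intro conjI ballI allI impI)
  let ?S = "topspace X" and ?U = "uniformity_from X \<B>"
  have le: "cover_entourage C \<subseteq> ?S \<times> ?S" if "C \<in> finite_covers X \<B>" for C
    using that unfolding finite_covers_def cover_entourage_def by blast
  have "\<exists>C. C \<in> finite_covers X \<B>"
  proof (cases "?S = {}")
    case True
    then have "{} \<in> finite_covers X \<B>" by (simp add: finite_covers_def)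
    then show ?thesis by blast
  next
    case False
    then have "?S \<in> \<B>" using BI[unfolded property_BI_def, rule_format, of "{}"] by simp
    then have "{?S} \<in> finite_covers X \<B>" by (simp add: finite_covers_def)
    then show ?thesis by blast
  qed
  then show "?S \<times> ?S \<in> ?U" using le unfolding uniformity_from_def by blast
  fix V assume V: "V \<in> ?U"
  then obtain C where C: "C \<in> finite_covers X \<B>" "cover_entourage C \<subseteq> V" "V \<subseteq> ?S \<times> ?S"
    unfolding uniformity_from_def by blast
  show "V \<subseteq> ?S \<times> ?S" by fact
  show "Id_on ?S \<subseteq> V"
    using C unfolding finite_covers_def cover_entourage_def by blast
  have "converse (cover_entourage C) = cover_entourage C"
    unfolding cover_entourage_def by blast
  then have "cover_entourage C \<subseteq> converse V" using C(2) by (metis converse_mono)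
  moreover have "converse V \<subseteq> ?S \<times> ?S" using C(3) by auto
  ultimately show "converse V \<in> ?U" using C(1) unfolding uniformity_from_def by blast
  show "W \<in> ?U" if "V \<subseteq> W \<and> W \<subseteq> ?S \<times> ?S" for W
    using C that unfolding uniformity_from_def by blast
  show "V \<inter> W \<in> ?U" if W: "W \<in> ?U" for W
  proof -
    obtain D where D: "D \<in> finite_covers X \<B>" "cover_entourage D \<subseteq> W"
      using W unfolding uniformity_from_def by blast
    define E where "E = (\<lambda>(Y, Z). Y \<inter> Z) ` (C \<times> D) - {{}}"
    have "finite E" using C(1) D(1) unfolding E_def finite_covers_def by auto
    moreover have "E \<subseteq> \<B>"
    proof
      fix T assume "T \<in> E"
      then obtain Y Z where YZ: "Y \<in> C" "Z \<in> D" "T = Y \<inter> Z" "T \<noteq> {}"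
        unfolding E_def by auto
      then have B: "Y \<in> \<B>" "Z \<in> \<B>"
        using C(1) D(1) unfolding finite_covers_def by auto
      have "Y \<subseteq> ?S" using sub[OF B(1)] by (rule openin_subset)
      then have "?S \<inter> \<Inter>{Y, Z} = T" using YZ by auto
      then show "T \<in> \<B>"
        using BI[unfolded property_BI_def, rule_format, of "{Y, Z}"] B YZ(4) by simp
    qed
    moreover have "\<Union>E = \<Union>C \<inter> \<Union>D" unfolding E_def by auto
    then have "\<Union>E = ?S" using C(1) D(1) by (simp add: finite_covers_def)
    ultimately have "E \<in> finite_covers X \<B>" by (simp add: finite_covers_def)
    moreover have "cover_entourage E \<subseteq> V \<inter> W"
    proof -
      have "cover_entourage E \<subseteq> cover_entourage C \<inter> cover_entourage D"
        unfolding E_def cover_entourage_def by auto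
      then show ?thesis using C(2) D(2) by (meson Int_mono order_trans)
    qed
    moreover have "V \<inter> W \<subseteq> ?S \<times> ?S" using C(3) by (rule le_infI1)
    ultimately show ?thesis unfolding uniformity_from_def by auto
  qed
  obtain C' where C': "C' \<in> finite_covers X \<B>"
    "\<forall>x\<in>?S. \<exists>Y\<in>C. \<Union>{Z\<in>C'. x \<in> Z} \<subseteq> Y"
    using BII C(1) unfolding property_BII_def by blast
  have "cover_entourage C' O cover_entourage C' \<subseteq> V"
  proof clarify
    fix x y z assume "(x, y) \<in> cover_entourage C'" "(y, z) \<in> cover_entourage C'"
    then obtain P Q where PQ: "P \<in> C'" "Q \<in> C'" "x \<in> P" "y \<in> P" "y \<in> Q" "z \<in> Q"
      unfolding cover_entourage_def by blast
    then have "y \<in> ?S" using C'(1) unfolding finite_covers_def by blast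
    then obtain Y where "Y \<in> C" "\<Union>{Z\<in>C'. y \<in> Z} \<subseteq> Y" using C'(2) by blast
    then have "(x, z) \<in> Y \<times> Y" using PQ by blast
    then show "(x, z) \<in> V" using C(2) \<open>Y \<in> C\<close> unfolding cover_entourage_def by blast
  qed
  moreover have "cover_entourage C' \<in> ?U"
    using C'(1) le unfolding uniformity_from_def by blast
  ultimately show "\<exists>W\<in>?U. W O W \<subseteq> V" by blast
qed

end

theory Submission
  imports Defs
begin

text \<open>
  The uniform structure determined by \<open>\<B>\<close> is totally bounded, because it is generated by finite
  covers (lemma \<open>totally_bounded_uniformity_from\<close>), and the completion of any totally bounded
  uniform structure is compact and Hausdorff (lemma \<open>compact_uniform_space_on_completion\<close>).

  Two facts carry the general result. Every Cauchy filter \<open>F\<close> contains a minimal one, its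
  \<^emph>\<open>rounding\<close>, which consists of the sets \<open>A\<close> such that, for some entourage \<open>V\<close>, the set of all \<open>x\<close>
  with \<open>V\<close>-neighbourhood inside \<open>A\<close> belongs to \<open>F\<close>. And in a totally bounded uniform structure every
  ultrafilter is Cauchy.

  For compactness, let \<open>S\<close> be the underlying set and suppose that an open cover \<open>\<O>\<close> of the
  completion has no finite subcover. Call \<open>A \<subseteq> S\<close> negligible if finitely many members of \<open>\<O>\<close> cover
  all points \<open>F\<close> of the completion that meet \<open>A\<close>, that is, for which \<open>A\<close> meets every set of \<open>F\<close>.
  As a filter that meets \<open>A \<union> B\<close> meets \<open>A\<close> or \<open>B\<close>, the negligible sets form an ideal, and it is
  proper. An ultrafilter \<open>D\<close> containing all complements of negligible sets is Cauchy; let \<open>F\<close> be its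
  rounding and let \<open>T \<in> \<O>\<close> contain \<open>F\<close>, hence all points \<open>V\<close>-close to \<open>F\<close> for some entourage \<open>V\<close>.
  If \<open>W O W \<subseteq> V\<close> and \<open>Y\<close> is a \<open>W\<close>-small set of \<open>F\<close>, then every point meeting \<open>Y\<close> is \<open>V\<close>-close to
  \<open>F\<close>, so \<open>T\<close> alone covers these points and \<open>Y\<close> is negligible. But \<open>Y\<close> also belongs to \<open>D\<close>, a
  contradiction. The argument uses filters on \<open>S\<close> only, never filters on the completion.
\<close>

section \<open>Ultrafilters\<close>

text \<open>
  Ultrafilters are minimal proper filters for the order on the type of filters. Zorn's lemma
  applies because the infimum of a nonempty chain of filters is simply their union as families of
  sets, so it does not contain the empty set unless some member does.
\<close>

lemma ex_ultrafilter_le: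
  fixes F :: "'a filter"
  assumes "F \<noteq> bot"
  obtains D where "D \<noteq> bot" "D \<le> F" "\<And>P. eventually P D \<or> eventually (\<lambda>x. \<not> P x) D"
proof -
  let ?A = "{G. G \<noteq> bot \<and> G \<le> F}"
  have "\<exists>D\<in>?A. \<forall>G\<in>?A. G \<le> D \<longrightarrow> G = D"
  proof (rule predicate_Zorn[where P = "\<lambda>G H. H \<le> G"])
    show "partial_order_on ?A (relation_of (\<lambda>G H. H \<le> G) ?A)"
      by (rule partial_order_on_relation_ofI) auto
    fix K assume K: "K \<in> Chains (relation_of (\<lambda>G H. H \<le> G) ?A)"
    then have sub: "K \<subseteq> ?A" and chain: "\<And>G H. G \<in> K \<Longrightarrow> H \<in> K \<Longrightarrow> G \<le> H \<or> H \<le> G"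
      unfolding Chains_def relation_of_def by blast+
    show "\<exists>G\<in>?A. \<forall>H\<in>K. G \<le> H"
    proof (cases "K = {}")
      case True
      then show ?thesis using assms by auto
    next
      case False
      have "\<exists>L\<in>K. L \<le> inf G H" if "G \<in> K" "H \<in> K" for G H
        using chain[OF that] that by (auto intro: le_infI)
      then have "eventually P (Inf K) \<longleftrightarrow> (\<exists>G\<in>K. eventually P G)" for P
        by (rule eventually_Inf_base[OF False])
      then have "Inf K \<noteq> bot"
        using sub by (auto simp: trivial_limit_def)
      moreover have "Inf K \<le> F"
        using False sub by (auto intro: Inf_lower2)
      ultimately show ?thesis by (auto intro: Inf_lower)
    qed
  qed
  then obtain D where D: "D \<noteq> bot" "D \<le> F"
    and min: "\<And>G. G \<noteq> bot \<Longrightarrow> G \<le> F \<Longrightarrow> G \<le> D \<Longrightarrow> G = D"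
    by blast
  have "eventually P D \<or> eventually (\<lambda>x. \<not> P x) D" for P
  proof (rule disjCI)
    assume "\<not> eventually (\<lambda>x. \<not> P x) D"
    then have "inf D (principal {x. P x}) \<noteq> bot"
      by (simp add: trivial_limit_def eventually_inf_principal)
    then have "inf D (principal {x. P x}) = D"
      using D(2) by (intro min) (auto intro: le_infI1)
    then have "D \<le> principal {x. P x}" by (metis inf.cobounded2)
    then show "eventually P D" by (simp add: le_principal)
  qed
  with D that show thesis by blast
qed

section \<open>Entourages and the uniform topology\<close>

lemma uniform_structure_onD:
  assumes "uniform_structure_on S \<U>"
  shows "S \<times> S \<in> \<U>"
    and "V \<in> \<U> \<Longrightarrow> V \<subseteq> S \<times> S"
    and "V \<in> \<U> \<Longrightarrow> x \<in> S \<Longrightarrow> (x, x) \<in> V"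
    and "V \<in> \<U> \<Longrightarrow> W \<in> \<U> \<Longrightarrow> V \<inter> W \<in> \<U>"
    and "V \<in> \<U> \<Longrightarrow> converse V \<in> \<U>"
proof -
  have "S \<times> S \<in> \<U> \<and> (\<forall>V\<in>\<U>. V \<subseteq> S \<times> S \<and> Id_on S \<subseteq> V) \<and>
      (\<forall>V\<in>\<U>. \<forall>W\<in>\<U>. V \<inter> W \<in> \<U>) \<and> (\<forall>V\<in>\<U>. converse V \<in> \<U>)"
    using assms unfolding uniform_structure_on_def by (elim conjE) (intro conjI)
  then show "S \<times> S \<in> \<U>"
    and "V \<in> \<U> \<Longrightarrow> V \<subseteq> S \<times> S"
    and "V \<in> \<U> \<Longrightarrow> x \<in> S \<Longrightarrow> (x, x) \<in> V"
    and "V \<in> \<U> \<Longrightarrow> W \<in> \<U> \<Longrightarrow> V \<inter> W \<in> \<U>"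
    and "V \<in> \<U> \<Longrightarrow> converse V \<in> \<U>"
    by blast+
qed

lemma uniform_structure_on_half:
  assumes "uniform_structure_on S \<U>" "V \<in> \<U>"
  obtains W where "W \<in> \<U>" "W O W \<subseteq> V"
proof -
  have "\<forall>V\<in>\<U>. \<exists>W\<in>\<U>. W O W \<subseteq> V"
    using assms(1) unfolding uniform_structure_on_def by (elim conjE)
  with assms(2) that show thesis by blast
qed

lemma uniform_structure_on_symmetric_half:
  assumes "uniform_structure_on S \<U>" "V \<in> \<U>"
  obtains W where "W \<in> \<U>" "converse W = W" "W O W \<subseteq> V"
proof -
  obtain W where W: "W \<in> \<U>" "W O W \<subseteq> V"
    using assms by (rule uniform_structure_on_half)
  show thesis
  proof
    show "W \<inter> converse W \<in> \<U>"
      using W(1) uniform_structure_onD[OF assms(1)] by blast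
    show "converse (W \<inter> converse W) = W \<inter> converse W" by blast
    show "(W \<inter> converse W) O (W \<inter> converse W) \<subseteq> V" using W(2) by blast
  qed
qed

text \<open>
  The set \<open>V `` {x}\<close> need not be open, but it is a neighbourhood of \<open>x\<close>: the points of which some
  entourage neighbourhood lies inside \<open>V `` {x}\<close> form an open set.
\<close>

lemma ex_openin_uniform_topology:
  assumes U: "uniform_structure_on S \<U>" and V: "V \<in> \<U>" and x: "x \<in> S"
  obtains T where "openin (uniform_topology S \<U>) T" "x \<in> T" "T \<subseteq> V `` {x}"
proof (rule that)
  define T where "T = {y \<in> S. \<exists>W\<in>\<U>. W `` {y} \<subseteq> V `` {x}}"
  show "openin (uniform_topology S \<U>) T"
    unfolding openin_uniform_topology[OF U]
  proof (intro conjI ballI)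
    show "T \<subseteq> S" unfolding T_def by blast
    fix y assume "y \<in> T"
    then obtain W where W: "W \<in> \<U>" "W `` {y} \<subseteq> V `` {x}" unfolding T_def by blast
    obtain W' where W': "W' \<in> \<U>" "W' O W' \<subseteq> W"
      using U W(1) by (rule uniform_structure_on_half)
    have "z \<in> T" if z: "(y, z) \<in> W'" for z
    proof -
      have "W' `` {z} \<subseteq> V `` {x}"
      proof
        fix w assume "w \<in> W' `` {z}"
        then have "(y, w) \<in> W" using z W'(2) by blast
        then show "w \<in> V `` {x}" using W(2) by blast
      qed
      moreover have "z \<in> S" using z uniform_structure_onD(2)[OF U W'(1)] by blast
      ultimately show ?thesis using W'(1) unfolding T_def by blast
    qed
    then have "W' `` {y} \<subseteq> T" by blast
    then show "\<exists>V\<in>\<U>. V `` {y} \<subseteq> T" using W'(1) by blast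
  qed
  show "x \<in> T" using x V unfolding T_def by blast
  show "T \<subseteq> V `` {x}"
  proof
    fix y assume "y \<in> T"
    then obtain W where W: "W \<in> \<U>" "W `` {y} \<subseteq> V `` {x}" and "y \<in> S"
      unfolding T_def by blast
    then have "(y, y) \<in> W" using uniform_structure_onD(3)[OF U] by blast
    then show "y \<in> V `` {x}" using W(2) by blast
  qed
qed

lemma Hausdorff_space_uniform_topology:
  assumes U: "uniform_structure_on S \<U>"
    and sep: "\<And>x y. x \<in> S \<Longrightarrow> y \<in> S \<Longrightarrow> (\<And>V. V \<in> \<U> \<Longrightarrow> (x, y) \<in> V) \<Longrightarrow> x = y"
  shows "Hausdorff_space (uniform_topology S \<U>)"
  unfolding Hausdorff_space_def topspace_uniform_topology[OF U]
proof (intro allI impI)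
  fix x y assume xy: "x \<in> S \<and> y \<in> S \<and> x \<noteq> y"
  then obtain V where V: "V \<in> \<U>" "(x, y) \<notin> V" using sep by blast
  obtain W where W: "W \<in> \<U>" "converse W = W" "W O W \<subseteq> V"
    using U V(1) by (rule uniform_structure_on_symmetric_half)
  obtain A where A: "openin (uniform_topology S \<U>) A" "x \<in> A" "A \<subseteq> W `` {x}"
    using ex_openin_uniform_topology[OF U W(1)] xy by blast
  obtain B where B: "openin (uniform_topology S \<U>) B" "y \<in> B" "B \<subseteq> W `` {y}"
    using ex_openin_uniform_topology[OF U W(1)] xy by blast
  have "disjnt A B" unfolding disjnt_iff
  proof (intro allI notI)
    fix z assume "z \<in> A \<and> z \<in> B"
    then have "(x, z) \<in> W" "(z, y) \<in> W" using A(3) B(3) W(2) by blast+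
    then show False using W(3) V(2) by blast
  qed
  then show "\<exists>A B. openin (uniform_topology S \<U>) A \<and> openin (uniform_topology S \<U>) B \<and>
      x \<in> A \<and> y \<in> B \<and> disjnt A B"
    using A B by blast
qed

section \<open>Minimal Cauchy filters\<close>

definition rounding :: "('a \<times> 'a) set set \<Rightarrow> 'a filter \<Rightarrow> 'a filter" where
  "rounding \<U> F = Abs_filter (\<lambda>P. \<exists>V\<in>\<U>. \<forall>\<^sub>F x in F. \<forall>y\<in>V `` {x}. P y)"

lemma eventually_rounding:
  assumes U: "uniform_structure_on S \<U>"
  shows "eventually P (rounding \<U> F) \<longleftrightarrow> (\<exists>V\<in>\<U>. \<forall>\<^sub>F x in F. \<forall>y\<in>V `` {x}. P y)"
  unfolding rounding_def
proof (rule eventually_Abs_filter, rule is_filter.intro)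
  show "\<exists>V\<in>\<U>. \<forall>\<^sub>F x in F. \<forall>y\<in>V `` {x}. True"
    using uniform_structure_onD(1)[OF U] by auto
next
  fix P Q
  assume "\<exists>V\<in>\<U>. \<forall>\<^sub>F x in F. \<forall>y\<in>V `` {x}. P y" "\<exists>V\<in>\<U>. \<forall>\<^sub>F x in F. \<forall>y\<in>V `` {x}. Q y"
  then obtain V W where VW: "V \<in> \<U>" "W \<in> \<U>"
    and PQ: "\<forall>\<^sub>F x in F. \<forall>y\<in>V `` {x}. P y" "\<forall>\<^sub>F x in F. \<forall>y\<in>W `` {x}. Q y" by blast
  from PQ have "\<forall>\<^sub>F x in F. \<forall>y\<in>(V \<inter> W) `` {x}. P y \<and> Q y"
    by eventually_elim blast
  then show "\<exists>V\<in>\<U>. \<forall>\<^sub>F x in F. \<forall>y\<in>V `` {x}. P y \<and> Q y"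
    using uniform_structure_onD(4)[OF U VW] by blast
next
  fix P Q :: "'a \<Rightarrow> bool"
  assume PQ: "\<forall>x. P x \<longrightarrow> Q x" and "\<exists>V\<in>\<U>. \<forall>\<^sub>F x in F. \<forall>y\<in>V `` {x}. P y"
  then obtain V where "V \<in> \<U>" "\<forall>\<^sub>F x in F. \<forall>y\<in>V `` {x}. P y" by blast
  moreover from this(2) have "\<forall>\<^sub>F x in F. \<forall>y\<in>V `` {x}. Q y"
    by (rule eventually_mono) (use PQ in blast)
  ultimately show "\<exists>V\<in>\<U>. \<forall>\<^sub>F x in F. \<forall>y\<in>V `` {x}. Q y" by blast
qed

lemma le_rounding:
  assumes U: "uniform_structure_on S \<U>" and F: "F \<le> principal S"
  shows "F \<le> rounding \<U> F"
proof (rule filter_leI)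
  fix P assume "eventually P (rounding \<U> F)"
  then obtain V where V: "V \<in> \<U>" and P: "\<forall>\<^sub>F x in F. \<forall>y\<in>V `` {x}. P y"
    unfolding eventually_rounding[OF U] by blast
  have "\<forall>\<^sub>F x in F. x \<in> S" using F by (simp add: le_principal)
  with P show "eventually P F"
  proof eventually_elim
    case (elim x)
    have "(x, x) \<in> V" using U V elim(2) by (rule uniform_structure_onD(3))
    then show "P x" using elim(1) by simp
  qed
qed

lemma cauchy_filter_rounding:
  assumes U: "uniform_structure_on S \<U>" and F: "cauchy_filter_on S \<U> F"
  shows "cauchy_filter_on S \<U> (rounding \<U> F)"
  unfolding cauchy_filter_on_def
proof (intro conjI ballI)
  have "F \<le> rounding \<U> F"
    using F by (intro le_rounding[OF U]) (simp add: cauchy_filter_on_def)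
  moreover have "F \<noteq> bot" using F by (simp add: cauchy_filter_on_def)
  ultimately show "rounding \<U> F \<noteq> bot" by (auto simp: bot_unique)
  have "\<forall>\<^sub>F x in F. \<forall>y\<in>(S \<times> S) `` {x}. y \<in> S" by (rule always_eventually) blast
  then show "rounding \<U> F \<le> principal S"
    unfolding le_principal eventually_rounding[OF U] using uniform_structure_onD(1)[OF U] by blast
  fix V assume "V \<in> \<U>"
  then obtain W where W: "W \<in> \<U>" "W O W \<subseteq> V"
    by (rule uniform_structure_on_half[OF U])
  obtain W' where W': "W' \<in> \<U>" "converse W' = W'" "W' O W' \<subseteq> W"
    using U W(1) by (rule uniform_structure_on_symmetric_half)
  \<comment> \<open>The neighbourhood of order \<open>W'\<close> of a \<open>W'\<close>-small set is small of order \<open>W' O W' O W'\<close>.\<close>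
  obtain Y where Y: "small_set W' Y" "\<forall>\<^sub>F x in F. x \<in> Y"
    using F W'(1) unfolding cauchy_filter_on_def by blast
  have "small_set V (W' `` Y)"
    unfolding small_set_def
  proof clarify
    fix a b y z assume *: "(y, a) \<in> W'" "y \<in> Y" "(z, b) \<in> W'" "z \<in> Y"
    then have "(a, y) \<in> W'" "(y, z) \<in> W'"
      using W'(2) Y(1) unfolding small_set_def by blast+
    moreover have "z \<in> S" using * W'(1) uniform_structure_onD(2)[OF U] by blast
    then have "(z, z) \<in> W'" using W'(1) uniform_structure_onD(3)[OF U] by blast
    ultimately have "(a, z) \<in> W" "(z, b) \<in> W" using * W'(3) by blast+
    then show "(a, b) \<in> V" using W(2) by blast
  qed
  moreover have "\<forall>\<^sub>F x in F. \<forall>y\<in>W' `` {x}. y \<in> W' `` Y"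
    using Y(2) by eventually_elim blast
  ultimately show "\<exists>Y. small_set V Y \<and> (\<forall>\<^sub>F x in rounding \<U> F. x \<in> Y)"
    unfolding eventually_rounding[OF U] using W'(1) by blast
qed

text \<open>
  A \<open>V\<close>-small set of \<open>F\<close> lies in the \<open>V\<close>-neighbourhood of each of its points. If it can be chosen to
  belong to \<open>G\<close> as well, it thus forces every set of the rounding of \<open>F\<close> into \<open>G\<close>.
\<close>

lemma le_rounding_of_common_small_sets:
  assumes U: "uniform_structure_on S \<U>" and F: "F \<noteq> bot"
    and common: "\<And>V. V \<in> \<U> \<Longrightarrow>
      \<exists>Y. small_set V Y \<and> (\<forall>\<^sub>F x in F. x \<in> Y) \<and> (\<forall>\<^sub>F x in G. x \<in> Y)"
  shows "G \<le> rounding \<U> F"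
proof (rule filter_leI)
  fix P assume "eventually P (rounding \<U> F)"
  then obtain V where V: "V \<in> \<U>" and P: "\<forall>\<^sub>F x in F. \<forall>y\<in>V `` {x}. P y"
    unfolding eventually_rounding[OF U] by blast
  obtain Y where Y: "small_set V Y" "\<forall>\<^sub>F x in F. x \<in> Y" "\<forall>\<^sub>F x in G. x \<in> Y"
    using common[OF V] by blast
  have "\<exists>x. (\<forall>y\<in>V `` {x}. P y) \<and> x \<in> Y"
    using eventually_happens[OF eventually_conj[OF P Y(2)]] F by blast
  then have "\<forall>y\<in>Y. P y" using Y(1) unfolding small_set_def by blast
  with Y(3) show "eventually P G" by (auto elim: eventually_mono)
qed

text \<open>
  A Cauchy filter \<open>G\<close> included in the rounding of \<open>F\<close> is included in \<open>F\<close>, so the small sets of \<open>G\<close>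
  are common to \<open>F\<close> and \<open>G\<close>, and by the preceding lemma \<open>G\<close> includes the rounding.
\<close>

lemma rounding_in_hausdorff_completion:
  assumes U: "uniform_structure_on S \<U>" and F: "cauchy_filter_on S \<U> F"
  shows "rounding \<U> F \<in> hausdorff_completion S \<U>"
  unfolding hausdorff_completion_def
proof (intro CollectI conjI allI impI)
  show "cauchy_filter_on S \<U> (rounding \<U> F)" using U F by (rule cauchy_filter_rounding)
  fix G assume G: "cauchy_filter_on S \<U> G \<and> rounding \<U> F \<le> G"
  have "F \<le> rounding \<U> F"
    using F by (intro le_rounding[OF U]) (simp add: cauchy_filter_on_def)
  then have FG: "F \<le> G" using G order_trans by blast
  have "G \<le> rounding \<U> F"
  proof (rule le_rounding_of_common_small_sets[OF U])
    show "F \<noteq> bot" using F by (simp add: cauchy_filter_on_def)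
    fix V assume "V \<in> \<U>"
    then obtain Y where "small_set V Y" "\<forall>\<^sub>F x in G. x \<in> Y"
      using G unfolding cauchy_filter_on_def by blast
    with FG show "\<exists>Y. small_set V Y \<and> (\<forall>\<^sub>F x in F. x \<in> Y) \<and> (\<forall>\<^sub>F x in G. x \<in> Y)"
      by (blast intro: filter_leD)
  qed
  then show "G = rounding \<U> F" using G by (intro antisym) auto
qed

lemma hausdorff_completionD:
  assumes "F \<in> hausdorff_completion S \<U>"
  shows "cauchy_filter_on S \<U> F" "F \<noteq> bot" "F \<le> principal S"
  using assms by (auto simp: hausdorff_completion_def cauchy_filter_on_def)

lemma rounding_minimal_cauchy_filter:
  assumes U: "uniform_structure_on S \<U>" and F: "F \<in> hausdorff_completion S \<U>"
  shows "rounding \<U> F = F"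
  using F cauchy_filter_rounding[OF U] le_rounding[OF U] hausdorff_completionD[OF F]
  unfolding hausdorff_completion_def by blast

section \<open>The completion is a separated uniform space\<close>

lemma small_set_Un:
  assumes "small_set W Y" "small_set W Z" "Y \<inter> Z \<noteq> {}" "W O W \<subseteq> V"
  shows "small_set V (Y \<union> Z)"
proof -
  obtain t where t: "t \<in> Y" "t \<in> Z" using assms(3) by blast
  have "(a, t) \<in> W" "(t, a) \<in> W" if "a \<in> Y \<union> Z" for a
    using that t assms(1,2) unfolding small_set_def by blast+
  then show ?thesis using assms(4) unfolding small_set_def by blast
qed

lemma completion_entourage_mono:
  "V \<subseteq> W \<Longrightarrow> completion_entourage S \<U> V \<subseteq> completion_entourage S \<U> W"
  unfolding completion_entourage_def small_set_def by blast

lemma converse_completion_entourage: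
  "converse (completion_entourage S \<U> V) = completion_entourage S \<U> V"
  unfolding completion_entourage_def by blast

text \<open>
  Small sets of the same filter intersect. Two filters that are close to a third one therefore have
  small sets whose union is small.
\<close>

lemma completion_entourage_comp:
  assumes "W O W \<subseteq> V"
  shows "completion_entourage S \<U> W O completion_entourage S \<U> W \<subseteq> completion_entourage S \<U> V"
proof clarify
  fix F G H
  assume FG: "(F, G) \<in> completion_entourage S \<U> W" and GH: "(G, H) \<in> completion_entourage S \<U> W"
  obtain Y where Y: "small_set W Y" "\<forall>\<^sub>F x in F. x \<in> Y" "\<forall>\<^sub>F x in G. x \<in> Y"
    using FG unfolding completion_entourage_def by blast
  obtain Z where Z: "small_set W Z" "\<forall>\<^sub>F x in G. x \<in> Z" "\<forall>\<^sub>F x in H. x \<in> Z"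
    using GH unfolding completion_entourage_def by blast
  have mem: "F \<in> hausdorff_completion S \<U>" "G \<in> hausdorff_completion S \<U>"
    "H \<in> hausdorff_completion S \<U>"
    using FG GH unfolding completion_entourage_def by blast+
  have "Y \<inter> Z \<noteq> {}"
    using eventually_happens[OF eventually_conj[OF Y(3) Z(2)]] hausdorff_completionD(2)[OF mem(2)]
    by blast
  then have "small_set V (Y \<union> Z)"
    using Y(1) Z(1) assms by (intro small_set_Un)
  moreover have "\<forall>\<^sub>F x in F. x \<in> Y \<union> Z" "\<forall>\<^sub>F x in H. x \<in> Y \<union> Z"
    using Y(2) Z(3) by (auto elim: eventually_mono)
  ultimately show "(F, H) \<in> completion_entourage S \<U> V"
    using mem unfolding completion_entourage_def by blast
qed

lemma completion_entourage_in_uniformity: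
  "V \<in> \<U> \<Longrightarrow> completion_entourage S \<U> V \<in> completion_uniformity S \<U>"
  unfolding completion_uniformity_def completion_entourage_def by blast

lemma uniform_structure_on_completion:
  assumes U: "uniform_structure_on S \<U>"
  shows "uniform_structure_on (hausdorff_completion S \<U>) (completion_uniformity S \<U>)"
  unfolding uniform_structure_on_def
proof (intro conjI ballI allI impI)
  let ?H = "hausdorff_completion S \<U>" and ?E = "completion_entourage S \<U>"
    and ?C = "completion_uniformity S \<U>"
  have le: "?E V \<subseteq> ?H \<times> ?H" for V unfolding completion_entourage_def by blast
  show "?H \<times> ?H \<in> ?C"
    using le uniform_structure_onD(1)[OF U] unfolding completion_uniformity_def by blast
  fix A assume "A \<in> ?C"
  then obtain V where V: "V \<in> \<U>" "?E V \<subseteq> A" "A \<subseteq> ?H \<times> ?H"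
    unfolding completion_uniformity_def by blast
  show "A \<subseteq> ?H \<times> ?H" by fact
  have "(F, F) \<in> ?E V" if "F \<in> ?H" for F
    using that hausdorff_completionD(1)[OF that] V(1)
    unfolding completion_entourage_def cauchy_filter_on_def by blast
  then show "Id_on ?H \<subseteq> A" using V(2) by blast
  show "B \<in> ?C" if "A \<subseteq> B \<and> B \<subseteq> ?H \<times> ?H" for B
    using that V unfolding completion_uniformity_def by blast
  show "A \<inter> B \<in> ?C" if "B \<in> ?C" for B
  proof -
    obtain W where W: "W \<in> \<U>" "?E W \<subseteq> B"
      using \<open>B \<in> ?C\<close> unfolding completion_uniformity_def by blast
    have "?E (V \<inter> W) \<subseteq> ?E V" "?E (V \<inter> W) \<subseteq> ?E W"
      by (intro completion_entourage_mono, blast)+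
    then have "?E (V \<inter> W) \<subseteq> A \<inter> B" using V(2) W(2) by blast
    then show ?thesis
      using V(3) uniform_structure_onD(4)[OF U V(1) W(1)]
      unfolding completion_uniformity_def by blast
  qed
  have "?E V \<subseteq> converse A"
    using V(2) converse_completion_entourage by (metis converse_mono)
  then show "converse A \<in> ?C" using V unfolding completion_uniformity_def by blast
  obtain W where W: "W \<in> \<U>" "W O W \<subseteq> V"
    using U V(1) by (rule uniform_structure_on_half)
  have "?E W O ?E W \<subseteq> A"
    using completion_entourage_comp[OF W(2)] V(2) by (rule order_trans)
  then show "\<exists>B\<in>?C. B O B \<subseteq> A"
    using completion_entourage_in_uniformity[OF W(1)] by blast
qed

text \<open>
  Two filters that no entourage separates have common small sets of every order. Each is then
  included in the other, as each is its own rounding.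
\<close>

lemma Hausdorff_space_completion:
  assumes U: "uniform_structure_on S \<U>"
  shows "Hausdorff_space
    (uniform_topology (hausdorff_completion S \<U>) (completion_uniformity S \<U>))"
proof (rule Hausdorff_space_uniform_topology[OF uniform_structure_on_completion[OF U]])
  fix F G
  assume mem: "F \<in> hausdorff_completion S \<U>" "G \<in> hausdorff_completion S \<U>"
    and close: "\<And>W. W \<in> completion_uniformity S \<U> \<Longrightarrow> (F, G) \<in> W"
  have common: "\<exists>Y. small_set V Y \<and> (\<forall>\<^sub>F x in F. x \<in> Y) \<and> (\<forall>\<^sub>F x in G. x \<in> Y)" if "V \<in> \<U>" for V
    using close[OF completion_entourage_in_uniformity[OF that]]
    unfolding completion_entourage_def by blast
  have "G \<le> rounding \<U> F" "F \<le> rounding \<U> G"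
    using common hausdorff_completionD(2)[OF mem(1)] hausdorff_completionD(2)[OF mem(2)]
    by (intro le_rounding_of_common_small_sets[OF U]; blast)+
  then show "F = G" using mem by (simp add: rounding_minimal_cauchy_filter[OF U])
qed

section \<open>Total boundedness and compactness\<close>

definition totally_bounded_uniformity :: "'a set \<Rightarrow> ('a \<times> 'a) set set \<Rightarrow> bool" where
  "totally_bounded_uniformity S \<U> \<longleftrightarrow>
     (\<forall>V\<in>\<U>. \<exists>C. finite C \<and> S \<subseteq> \<Union>C \<and> (\<forall>Y\<in>C. small_set V Y))"

text \<open>
  An ultrafilter on \<open>S\<close> contains a member of every finite cover of \<open>S\<close>, in particular of a cover by
  \<open>V\<close>-small sets.
\<close>

lemma ultrafilter_cauchy:
  assumes tb: "totally_bounded_uniformity S \<U>"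
    and D: "D \<noteq> bot" "D \<le> principal S"
    and ultra: "\<And>P. eventually P D \<or> eventually (\<lambda>x. \<not> P x) D"
  shows "cauchy_filter_on S \<U> D"
  unfolding cauchy_filter_on_def
proof (intro conjI ballI D)
  fix V assume "V \<in> \<U>"
  then obtain C where C: "finite C" "S \<subseteq> \<Union>C" "\<forall>Y\<in>C. small_set V Y"
    using tb unfolding totally_bounded_uniformity_def by blast
  have "\<forall>\<^sub>F x in D. \<exists>Y\<in>C. x \<in> Y"
    using D(2)[unfolded le_principal] by (rule eventually_mono) (use C(2) in blast)
  then have "\<exists>\<^sub>F x in D. \<exists>Y\<in>C. x \<in> Y" using D(1) by (intro eventually_frequently)
  then obtain Y where "Y \<in> C" "\<exists>\<^sub>F x in D. x \<in> Y"
    using C(1) by (auto simp: frequently_bex_finite_distrib)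
  then have "\<forall>\<^sub>F x in D. x \<in> Y" using ultra[of "\<lambda>x. x \<in> Y"] by (simp add: frequently_def)
  with \<open>Y \<in> C\<close> C(3) show "\<exists>Y. small_set V Y \<and> (\<forall>\<^sub>F x in D. x \<in> Y)" by blast
qed

text \<open>
  A filter \<open>G\<close> that only \<^emph>\<open>meets\<close> the small set \<open>Y\<close> is already close to \<open>F\<close>: a small set of \<open>G\<close>
  intersects \<open>Y\<close>, and the union of the two is a common small set.
\<close>

lemma frequently_small_set_close:
  assumes F: "F \<in> hausdorff_completion S \<U>" and G: "G \<in> hausdorff_completion S \<U>"
    and W: "W \<in> \<U>" "W O W \<subseteq> V"
    and Y: "small_set W Y" "\<forall>\<^sub>F x in F. x \<in> Y" "\<exists>\<^sub>F x in G. x \<in> Y"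
  shows "(F, G) \<in> completion_entourage S \<U> V"
proof -
  obtain Z where Z: "small_set W Z" "\<forall>\<^sub>F x in G. x \<in> Z"
    using hausdorff_completionD(1)[OF G] W(1) unfolding cauchy_filter_on_def by blast
  have "\<forall>\<^sub>F x in G. x \<in> Y \<longrightarrow> x \<in> Y \<and> x \<in> Z" using Z(2) by eventually_elim blast
  then have "\<exists>\<^sub>F x in G. x \<in> Y \<and> x \<in> Z" using Y(3) by (rule frequently_mp)
  then have "Y \<inter> Z \<noteq> {}" by (auto dest: frequently_ex)
  then have "small_set V (Y \<union> Z)"
    using Y(1) Z(1) W(2) by (intro small_set_Un)
  moreover have "\<forall>\<^sub>F x in F. x \<in> Y \<union> Z" "\<forall>\<^sub>F x in G. x \<in> Y \<union> Z"
    using Y(2) Z(2) by (auto elim: eventually_mono)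
  ultimately show ?thesis using F G unfolding completion_entourage_def by blast
qed

lemma compact_space_completion:
  assumes U: "uniform_structure_on S \<U>" and tb: "totally_bounded_uniformity S \<U>"
  shows "compact_space (uniform_topology (hausdorff_completion S \<U>) (completion_uniformity S \<U>))"
    (is "compact_space ?T")
proof -
  let ?H = "hausdorff_completion S \<U>"
  note UH = uniform_structure_on_completion[OF U]
  show ?thesis
    unfolding compact_space_alt topspace_uniform_topology[OF UH]
  proof (intro allI impI, rule ccontr)
    fix \<O> assume \<O>: "(\<forall>T\<in>\<O>. openin ?T T) \<and> ?H \<subseteq> \<Union>\<O>"
    assume no_finite: "\<not> (\<exists>\<F>. finite \<F> \<and> \<F> \<subseteq> \<O> \<and> ?H \<subseteq> \<Union>\<F>)"
    \<comment> \<open>\<open>\<exists>\<^sub>F x in F. x \<in> A\<close> means that \<open>A\<close> meets every set of \<open>F\<close>; unlike membership in \<open>F\<close>, this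
      condition distributes over unions.\<close>
    define neg where "neg = (\<lambda>A. \<exists>\<F>. finite \<F> \<and> \<F> \<subseteq> \<O> \<and> {F \<in> ?H. \<exists>\<^sub>F x in F. x \<in> A} \<subseteq> \<Union>\<F>)"
    have neg_mono: "neg A" if "A \<subseteq> B" "neg B" for A B
    proof -
      have "{F \<in> ?H. \<exists>\<^sub>F x in F. x \<in> A} \<subseteq> {F \<in> ?H. \<exists>\<^sub>F x in F. x \<in> B}"
        using \<open>A \<subseteq> B\<close> by (auto elim!: frequently_elim1)
      with \<open>neg B\<close> show ?thesis unfolding neg_def by (meson order_trans)
    qed
    have neg_empty: "neg {}" unfolding neg_def by (rule exI[of _ "{}"]) simp
    have neg_Un: "neg (A \<union> B)" if "neg A" "neg B" for A B
    proof -
      obtain \<F> where F: "finite \<F>" "\<F> \<subseteq> \<O>" "{F \<in> ?H. \<exists>\<^sub>F x in F. x \<in> A} \<subseteq> \<Union>\<F>"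
        using \<open>neg A\<close> unfolding neg_def by (elim exE conjE)
      obtain \<G> where G: "finite \<G>" "\<G> \<subseteq> \<O>" "{F \<in> ?H. \<exists>\<^sub>F x in F. x \<in> B} \<subseteq> \<Union>\<G>"
        using \<open>neg B\<close> unfolding neg_def by (elim exE conjE)
      have "{F \<in> ?H. \<exists>\<^sub>F x in F. x \<in> A \<union> B} \<subseteq> \<Union>(\<F> \<union> \<G>)"
        using F(3) G(3) unfolding Un_iff frequently_disj_iff by blast
      moreover have "finite (\<F> \<union> \<G>)" "\<F> \<union> \<G> \<subseteq> \<O>" using F G by simp_all
      ultimately show ?thesis unfolding neg_def by (intro exI[of _ "\<F> \<union> \<G>"] conjI)
    qed
    have not_neg_S: "\<not> neg S"
    proof
      assume "neg S"
      moreover have "\<exists>\<^sub>F x in F. x \<in> S" if "F \<in> ?H" for F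
        using hausdorff_completionD(2,3)[OF that] unfolding le_principal
        by (rule eventually_frequently)
      ultimately show False using no_finite unfolding neg_def by blast
    qed
    \<comment> \<open>The filter of complements of negligible sets; it is proper as \<open>S\<close> is not negligible.\<close>
    define N where "N = Abs_filter (\<lambda>P. neg {x \<in> S. \<not> P x})"
    have ev_N: "eventually P N \<longleftrightarrow> neg {x \<in> S. \<not> P x}" for P
      unfolding N_def
    proof (rule eventually_Abs_filter, rule is_filter.intro)
      show "neg {x \<in> S. \<not> True}" using neg_empty by simp
      show "neg {x \<in> S. \<not> (P x \<and> Q x)}" if "neg {x \<in> S. \<not> P x}" "neg {x \<in> S. \<not> Q x}" for P Q
        by (rule neg_mono[OF _ neg_Un[OF that]]) blast
      show "neg {x \<in> S. \<not> Q x}" if "\<forall>x. P x \<longrightarrow> Q x" "neg {x \<in> S. \<not> P x}" for P Q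
        by (rule neg_mono[OF _ that(2)]) (use that(1) in blast)
    qed
    have "N \<noteq> bot" using not_neg_S by (simp add: trivial_limit_def ev_N)
    then obtain D where D: "D \<noteq> bot" "D \<le> N"
      and ultra: "\<And>P. eventually P D \<or> eventually (\<lambda>x. \<not> P x) D"
      by (rule ex_ultrafilter_le) blast
    have "eventually (\<lambda>x. x \<in> S) N" using neg_empty by (simp add: ev_N)
    then have DS: "D \<le> principal S" using D(2) unfolding le_principal by (rule filter_leD[rotated])
    let ?F = "rounding \<U> D"
    have FH: "?F \<in> ?H"
      using ultrafilter_cauchy[OF tb D(1) DS ultra] by (rule rounding_in_hausdorff_completion[OF U])
    then obtain T where T: "T \<in> \<O>" "?F \<in> T" using \<O> by blast
    have "openin ?T T" using \<O> T(1) by blast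
    then obtain A where A: "A \<in> completion_uniformity S \<U>" "A `` {?F} \<subseteq> T"
      unfolding openin_uniform_topology[OF UH] using T(2) by blast
    obtain V where V: "V \<in> \<U>" "completion_entourage S \<U> V \<subseteq> A"
      using A(1) unfolding completion_uniformity_def by blast
    obtain W where W: "W \<in> \<U>" "W O W \<subseteq> V" using U V(1) by (rule uniform_structure_on_half)
    obtain Y where Y: "small_set W Y" "\<forall>\<^sub>F x in ?F. x \<in> Y"
      using hausdorff_completionD(1)[OF FH] W(1) unfolding cauchy_filter_on_def by blast
    have "{G \<in> ?H. \<exists>\<^sub>F x in G. x \<in> Y} \<subseteq> \<Union>{T}"
    proof
      fix G assume "G \<in> {G \<in> ?H. \<exists>\<^sub>F x in G. x \<in> Y}"
      then have "(?F, G) \<in> completion_entourage S \<U> V"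
        using frequently_small_set_close[OF FH _ W Y] by blast
      then show "G \<in> \<Union>{T}" using V(2) A(2) by blast
    qed
    then have "neg Y" using T(1) unfolding neg_def by (intro exI[of _ "{T}"]) simp
    then have "neg {x \<in> S. \<not> x \<notin> Y}" by (rule neg_mono[rotated]) blast
    then have "\<forall>\<^sub>F x in D. x \<notin> Y" using D(2) by (auto simp: ev_N intro: filter_leD)
    moreover have "\<forall>\<^sub>F x in D. x \<in> Y" using le_rounding[OF U DS] Y(2) by (rule filter_leD)
    ultimately have "\<forall>\<^sub>F x in D. False" by eventually_elim blast
    with D(1) show False by (simp add: trivial_limit_def)
  qed
qed

lemma compact_uniform_space_on_completion:
  assumes "uniform_structure_on S \<U>" "totally_bounded_uniformity S \<U>"
  shows "compact_uniform_space_on (hausdorff_completion S \<U>) (completion_uniformity S \<U>)"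
  unfolding compact_uniform_space_on_def
  using uniform_structure_on_completion Hausdorff_space_completion compact_space_completion assms
  by blast

lemma totally_bounded_uniformity_from:
  "totally_bounded_uniformity (topspace X) (uniformity_from X \<B>)"
  unfolding totally_bounded_uniformity_def
proof
  fix V assume "V \<in> uniformity_from X \<B>"
  then obtain C where "C \<in> finite_covers X \<B>" "cover_entourage C \<subseteq> V"
    unfolding uniformity_from_def by blast
  then show "\<exists>C. finite C \<and> topspace X \<subseteq> \<Union>C \<and> (\<forall>Y\<in>C. small_set V Y)"
    unfolding finite_covers_def cover_entourage_def small_set_def
    by (intro exI[of _ C]) auto
qed

theorem proposition3p5:
  fixes X :: "'a topology" and \<B> :: "'a set set"
  assumes "\<And>U. U \<in> \<B> \<Longrightarrow> openin X U"
    and "property_BI X \<B>"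
    and "property_BII X \<B>"
  shows "compact_uniform_space_on
           (hausdorff_completion (topspace X) (uniformity_from X \<B>))
           (completion_uniformity (topspace X) (uniformity_from X \<B>))"
  using uniform_structure_on_uniformity_from[OF assms] totally_bounded_uniformity_from
  by (rule compact_uniform_space_on_completion)

end
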